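(* Let $(D,+,\cdot)$ be a distributive lattice and let $S=\bigcup_{\alpha\in D}G_\alpha$ be a strong distributive lattice of group semirings $G_\alpha$ ($\alpha\in D$), with connecting homomorphisms $\{\phi_{\alpha,\beta}:G_\alpha\to G_\beta \mid \beta\le\alpha\}$ and $\{\psi_{\beta,\alpha}:G_\beta\to G_\alpha \mid \beta\le\alpha\}$. For each $\alpha\in D$ let $e_\alpha$ denote the identity of the group $(G_\alpha,\cdot)$. Then: (i) If $\beta\le\alpha$ in $D$, then $e_\alpha e_\beta=e_\beta$ and $e_\alpha+e_\beta=e_\alpha$. (ii) If $x\in G_\alpha$ and $y,y'\in G_\beta$ for some $\alpha,\beta\in D$, then $x+y=x+y'$. (iii) For $\beta\le\alpha$, $x\phi_{\alpha,\beta}=xe_\beta$ for all $x\in G_\alpha$, and $y\psi_{\beta,\alpha}=y+e_\alpha$ for all $y\in G_\beta$. (iv) If $\gamma\le\beta\le\alpha$ in $D$, then $\phi_{\alpha,\beta}\phi_{\beta,\gamma}=\phi_{\alpha,\gamma}$. (v) If $\beta\le\alpha$ in $D$, then $\phi_{\alpha,\beta}:G_\alpha\to G_\beta$ is an isomorphism and $\psi_{\beta,\alpha}=(\phi_{\alpha,\beta})^{-1}$. (vi) If $\alpha,\beta,\gamma,\delta\in D$ satisfy $\alpha+\beta\le\delta$ and $\gamma\le\alpha\beta$, then $\phi_{\alpha,\gamma}\psi_{\gamma,\beta}=\psi_{\alpha,\delta}\phi_{\delta,\beta}$.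
   Context: Maps are written on the right of their arguments and composed left to right: $x(\phi\psi)=(x\phi)\psi$. A semiring is a structure $(S,+,\cdot)$ where $(S,+)$ and $(S,\cdot)$ are semigroups (addition need not be commutative, and no zero or one is required) and $x(y+z)=xy+xz$, $(x+y)z=xz+yz$ for all $x,y,z$. Homomorphisms of semirings preserve $+$ and $\cdot$. A group semiring is a semiring $(G,+,\cdot)$ where $(G,\cdot)$ is a group and $x+y=x$ for all $x,y\in G$. In a distributive lattice $(D,+,\cdot)$, $+$ denotes join, $\cdot$ denotes meet, and $\beta\le\alpha$ means $\alpha\beta=\beta$. A distributive lattice of semirings is a semiring $S$ which is a disjoint union $S=\bigcup_{\alpha\in D}S_\alpha$ of semirings $S_\alpha$ (each with the operations inherited from $S$) indexed by a distributive lattice $D$, such that $x+y\in S_{\alpha+\beta}$ and $xy\in S_{\alpha\beta}$ whenever $x\in S_\alpha$, $y\in S_\beta$. Such an $S$ is a strong distributive lattice of semirings if there are two families of semiring homomorphisms (the connecting homomorphisms) $\{\phi_{\alpha,\beta}:S_\alpha\to S_\beta\mid\beta\le\alpha\}$ and $\{\psi_{\beta,\alpha}:S_\beta\to S_\alpha\mid\beta\le\alpha\}$ such that: - $\phi_{\alpha,\alpha}$ and $\psi_{\alpha,\alpha}$ are the identity map of $S_\alpha$; - $\phi_{\alpha,\beta}\phi_{\beta,\gamma}=\phi_{\alpha,\gamma}$ and $\psi_{\gamma,\beta}\psi_{\beta,\alpha}=\psi_{\gamma,\alpha}$ whenever $\gamma\le\beta\le\alpha$; - if $\alpha+\beta\le\delta$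 then $\phi_{\alpha,\alpha\beta}\psi_{\alpha\beta,\beta}=\psi_{\alpha,\delta}\phi_{\delta,\beta}$; - for $x\in S_\alpha$ and $y\in S_\beta$, $xy=(x\phi_{\alpha,\alpha\beta})(y\phi_{\beta,\alpha\beta})$ and $x+y=x\psi_{\alpha,\alpha+\beta}+y\psi_{\beta,\alpha+\beta}$. A strong distributive lattice of group semirings is a strong distributive lattice of semirings in which every $S_\alpha=G_\alpha$ is a group semiring; in that case $x+y=x\psi_{\alpha,\alpha+\beta}$ for $x\in G_\alpha$, $y\in G_\beta$. *)

theory Defs
  imports "HOL-Algebra.Group"
begin

text \<open>
  Semirings are given by a carrier set together with two operations on the surrounding type, so
  that a component of a disjoint union carries the inherited operations simply by changing the
  carrier.  Unlike the classes of HOL, addition need not be commutative and there need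
  not be a zero or a one.
\<close>

locale semiring_on =
  fixes S :: "'a set"
    and add :: "'a \<Rightarrow> 'a \<Rightarrow> 'a" (infixl "\<boxplus>" 65)
    and mul :: "'a \<Rightarrow> 'a \<Rightarrow> 'a" (infixl "\<odot>" 70)
  assumes add_closed: "\<lbrakk>x \<in> S; y \<in> S\<rbrakk> \<Longrightarrow> x \<boxplus> y \<in> S"
    and add_assoc: "\<lbrakk>x \<in> S; y \<in> S; z \<in> S\<rbrakk> \<Longrightarrow> (x \<boxplus> y) \<boxplus> z = x \<boxplus> (y \<boxplus> z)"
    and mul_closed: "\<lbrakk>x \<in> S; y \<in> S\<rbrakk> \<Longrightarrow> x \<odot> y \<in> S"
    and mul_assoc: "\<lbrakk>x \<in> S; y \<in> S; z \<in> S\<rbrakk> \<Longrightarrow> (x \<odot> y) \<odot> z = x \<odot> (y \<odot> z)"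
    and distrib_left: "\<lbrakk>x \<in> S; y \<in> S; z \<in> S\<rbrakk> \<Longrightarrow> x \<odot> (y \<boxplus> z) = (x \<odot> y) \<boxplus> (x \<odot> z)"
    and distrib_right: "\<lbrakk>x \<in> S; y \<in> S; z \<in> S\<rbrakk> \<Longrightarrow> (x \<boxplus> y) \<odot> z = (x \<odot> z) \<boxplus> (y \<odot> z)"

text \<open>
  Homomorphisms are only needed between subsets of one ambient semiring, hence a single pair of
  operations.  Only the values of a map on its source carrier matter.
\<close>

definition semiring_hom ::
    "('a \<Rightarrow> 'a \<Rightarrow> 'a) \<Rightarrow> ('a \<Rightarrow> 'a \<Rightarrow> 'a) \<Rightarrow> 'a set \<Rightarrow> 'a set \<Rightarrow> ('a \<Rightarrow> 'a) set" where
  "semiring_hom add mul A B =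
    {f \<in> A \<rightarrow> B. \<forall>x\<in>A. \<forall>y\<in>A. f (add x y) = add (f x) (f y) \<and> f (mul x y) = mul (f x) (f y)}"

definition semiring_iso ::
    "('a \<Rightarrow> 'a \<Rightarrow> 'a) \<Rightarrow> ('a \<Rightarrow> 'a \<Rightarrow> 'a) \<Rightarrow> 'a set \<Rightarrow> 'a set \<Rightarrow> ('a \<Rightarrow> 'a) set" where
  "semiring_iso add mul A B = {f \<in> semiring_hom add mul A B. bij_betw f A B}"

locale group_semiring = semiring_on +
  assumes mul_group: "\<exists>e. group \<lparr>carrier = S, mult = mul, one = e\<rparr>"
    and add_left_zero: "\<lbrakk>x \<in> S; y \<in> S\<rbrakk> \<Longrightarrow> x \<boxplus> y = x"

text \<open>
  The index lattice is the type \<open>'d\<close>, with \<^const>\<open>sup\<close> as addition (join) and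
  \<^const>\<open>inf\<close> as multiplication (meet).
\<close>

locale distrib_lattice_of_semirings =
  semiring_on S add mul
  for S :: "'a set"
    and add :: "'a \<Rightarrow> 'a \<Rightarrow> 'a" (infixl "\<boxplus>" 65)
    and mul :: "'a \<Rightarrow> 'a \<Rightarrow> 'a" (infixl "\<odot>" 70) +
  fixes C :: "'d::distrib_lattice \<Rightarrow> 'a set"
  assumes union: "S = (\<Union>\<alpha>. C \<alpha>)"
    and disjoint: "\<alpha> \<noteq> \<beta> \<Longrightarrow> C \<alpha> \<inter> C \<beta> = {}"
    and component: "semiring_on (C \<alpha>) add mul"
    and add_mem: "\<lbrakk>x \<in> C \<alpha>; y \<in> C \<beta>\<rbrakk> \<Longrightarrow> x \<boxplus> y \<in> C (sup \<alpha> \<beta>)"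
    and mul_mem: "\<lbrakk>x \<in> C \<alpha>; y \<in> C \<beta>\<rbrakk> \<Longrightarrow> x \<odot> y \<in> C (inf \<alpha> \<beta>)"

text \<open>
  For \<open>\<beta> \<le> \<alpha>\<close>, \<open>\<phi> \<alpha> \<beta>\<close> maps \<open>C \<alpha>\<close> to \<open>C \<beta>\<close> and \<open>\<psi> \<beta> \<alpha>\<close> maps \<open>C \<beta>\<close> to \<open>C \<alpha>\<close>: source
  index first.  Other index pairs are unconstrained.  Composites of maps written on the right
  appear here in the opposite order.
\<close>

locale strong_distrib_lattice_of_semirings =
  distrib_lattice_of_semirings S add mul C
  for S :: "'a set"
    and add :: "'a \<Rightarrow> 'a \<Rightarrow> 'a" (infixl "\<boxplus>" 65)
    and mul :: "'a \<Rightarrow> 'a \<Rightarrow> 'a" (infixl "\<odot>" 70)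
    and C :: "'d::distrib_lattice \<Rightarrow> 'a set" +
  fixes \<phi> \<psi> :: "'d \<Rightarrow> 'd \<Rightarrow> 'a \<Rightarrow> 'a"
  assumes phi_hom: "\<beta> \<le> \<alpha> \<Longrightarrow> \<phi> \<alpha> \<beta> \<in> semiring_hom add mul (C \<alpha>) (C \<beta>)"
    and psi_hom: "\<beta> \<le> \<alpha> \<Longrightarrow> \<psi> \<beta> \<alpha> \<in> semiring_hom add mul (C \<beta>) (C \<alpha>)"
    and phi_id: "x \<in> C \<alpha> \<Longrightarrow> \<phi> \<alpha> \<alpha> x = x"
    and psi_id: "x \<in> C \<alpha> \<Longrightarrow> \<psi> \<alpha> \<alpha> x = x"
    and phi_comp: "\<lbrakk>\<gamma> \<le> \<beta>; \<beta> \<le> \<alpha>; x \<in> C \<alpha>\<rbrakk> \<Longrightarrow> \<phi> \<beta> \<gamma> (\<phi> \<alpha> \<beta> x) = \<phi> \<alpha> \<gamma> x"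
    and psi_comp: "\<lbrakk>\<gamma> \<le> \<beta>; \<beta> \<le> \<alpha>; x \<in> C \<gamma>\<rbrakk> \<Longrightarrow> \<psi> \<beta> \<alpha> (\<psi> \<gamma> \<beta> x) = \<psi> \<gamma> \<alpha> x"
    and phi_psi: "\<lbrakk>sup \<alpha> \<beta> \<le> \<delta>; x \<in> C \<alpha>\<rbrakk> \<Longrightarrow>
        \<psi> (inf \<alpha> \<beta>) \<beta> (\<phi> \<alpha> (inf \<alpha> \<beta>) x) = \<phi> \<delta> \<beta> (\<psi> \<alpha> \<delta> x)"
    and mul_eq: "\<lbrakk>x \<in> C \<alpha>; y \<in> C \<beta>\<rbrakk> \<Longrightarrow>
        x \<odot> y = \<phi> \<alpha> (inf \<alpha> \<beta>) x \<odot> \<phi> \<beta> (inf \<alpha> \<beta>) y"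
    and add_eq: "\<lbrakk>x \<in> C \<alpha>; y \<in> C \<beta>\<rbrakk> \<Longrightarrow>
        x \<boxplus> y = \<psi> \<alpha> (sup \<alpha> \<beta>) x \<boxplus> \<psi> \<beta> (sup \<alpha> \<beta>) y"

locale strong_distrib_lattice_of_group_semirings =
  strong_distrib_lattice_of_semirings S add mul G \<phi> \<psi>
  for S :: "'a set"
    and add :: "'a \<Rightarrow> 'a \<Rightarrow> 'a" (infixl "\<boxplus>" 65)
    and mul :: "'a \<Rightarrow> 'a \<Rightarrow> 'a" (infixl "\<odot>" 70)
    and G :: "'d::distrib_lattice \<Rightarrow> 'a set"
    and \<phi> \<psi> :: "'d \<Rightarrow> 'd \<Rightarrow> 'a \<Rightarrow> 'a" +
  assumes component_group_semiring: "group_semiring (G \<alpha>) add mul"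

end

theory Submission
  imports Defs
begin

text \<open>
  Addition collapses to \<open>x \<boxplus> y = \<psi> \<alpha> (sup \<alpha> \<beta>) x\<close>.  The compatibility axiom makes \<open>\<psi> \<beta> \<alpha>\<close> a right
  inverse of \<open>\<phi> \<alpha> \<beta>\<close> but says nothing about the other composite; that one comes from left
  distributivity across components.  For \<open>x, z \<in> G \<alpha>\<close> and \<open>y \<in> G \<beta>\<close> with \<open>\<beta> \<le> \<alpha>\<close>, expanding
  \<open>x \<odot> (y \<boxplus> z) = x \<odot> y \<boxplus> x \<odot> z\<close> gives \<open>x \<odot> \<psi> y = \<psi> (\<phi> x \<odot> y) = \<psi> (\<phi> x) \<odot> \<psi> y\<close>, and
  cancelling \<open>\<psi> y\<close> in the group \<open>G \<alpha>\<close> yields \<open>\<psi> (\<phi> x) = x\<close>.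
\<close>

context strong_distrib_lattice_of_semirings
begin

lemma phi_closed: "\<lbrakk>\<beta> \<le> \<alpha>; x \<in> C \<alpha>\<rbrakk> \<Longrightarrow> \<phi> \<alpha> \<beta> x \<in> C \<beta>"
  using phi_hom by (auto simp: semiring_hom_def)

lemma psi_closed: "\<lbrakk>\<beta> \<le> \<alpha>; y \<in> C \<beta>\<rbrakk> \<Longrightarrow> \<psi> \<beta> \<alpha> y \<in> C \<alpha>"
  using psi_hom by (auto simp: semiring_hom_def)

lemma phi_mul:
  "\<lbrakk>\<beta> \<le> \<alpha>; x \<in> C \<alpha>; y \<in> C \<alpha>\<rbrakk> \<Longrightarrow> \<phi> \<alpha> \<beta> (x \<odot> y) = \<phi> \<alpha> \<beta> x \<odot> \<phi> \<alpha> \<beta> y"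
  using phi_hom by (auto simp: semiring_hom_def)

lemma psi_mul:
  "\<lbrakk>\<beta> \<le> \<alpha>; x \<in> C \<beta>; y \<in> C \<beta>\<rbrakk> \<Longrightarrow> \<psi> \<beta> \<alpha> (x \<odot> y) = \<psi> \<beta> \<alpha> x \<odot> \<psi> \<beta> \<alpha> y"
  using psi_hom by (auto simp: semiring_hom_def)

text \<open>The meet of the two indices is \<beta>, and \<open>\<phi> \<beta> \<beta>\<close> is the
  identity, so only the left factor moves.\<close>

lemma mul_eq_phi:
  assumes "\<beta> \<le> \<alpha>" "x \<in> C \<alpha>" "y \<in> C \<beta>"
  shows "x \<odot> y = \<phi> \<alpha> \<beta> x \<odot> y"
  using mul_eq[OF assms(2,3)] assms by (simp add: inf_absorb2 phi_id)

text \<open>This is the compatibility axiom with both lower indices equal to \<beta>: its left side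
  is then a composite of identity maps.\<close>

lemma phi_psi_inverse:
  assumes "\<beta> \<le> \<alpha>" "y \<in> C \<beta>"
  shows "\<phi> \<alpha> \<beta> (\<psi> \<beta> \<alpha> y) = y"
  using phi_psi[of \<beta> \<beta> \<alpha> y] assms by (simp add: phi_id psi_id)

end

context strong_distrib_lattice_of_group_semirings
begin

text \<open>Both images lie in the component of the join, where addition returns its left
  argument.\<close>

lemma add_eq_psi:
  assumes "x \<in> G \<alpha>" "y \<in> G \<beta>"
  shows "x \<boxplus> y = \<psi> \<alpha> (sup \<alpha> \<beta>) x"
  using add_eq[OF assms]
    group_semiring.add_left_zero[OF component_group_semiring
      psi_closed[OF sup.cobounded1 assms(1)] psi_closed[OF sup.cobounded2 assms(2)]]
  by simp

lemma component_groupE: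
  obtains e where "group \<lparr>carrier = G \<alpha>, mult = mul, one = e\<rparr>"
  using group_semiring.mul_group[OF component_group_semiring] by blast

lemma component_nonempty: "\<exists>y. y \<in> G \<alpha>"
proof -
  obtain e where "group \<lparr>carrier = G \<alpha>, mult = mul, one = e\<rparr>"
    by (rule component_groupE)
  from monoid.one_closed[OF group.is_monoid[OF this]] show ?thesis
    by auto
qed

lemma right_cancel_component:
  assumes "x \<in> G \<alpha>" "y \<in> G \<alpha>" "z \<in> G \<alpha>" "x \<odot> z = y \<odot> z"
  shows "x = y"
proof -
  obtain e where "group \<lparr>carrier = G \<alpha>, mult = mul, one = e\<rparr>"
    by (rule component_groupE)
  from group.right_cancel[OF this, of z x y] show ?thesis
    using assms by simp
qed

lemma psi_phi_inverse:
  assumes "\<beta> \<le> \<alpha>" "x \<in> G \<alpha>"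
  shows "\<psi> \<beta> \<alpha> (\<phi> \<alpha> \<beta> x) = x"
proof -
  \<comment> \<open>Any element of \<open>G \<beta>\<close> will do: it is an auxiliary factor that
    is cancelled at the end.\<close>
  obtain y where y: "y \<in> G \<beta>"
    using component_nonempty by blast
  have mem: "\<phi> \<alpha> \<beta> x \<in> G \<beta>" "\<psi> \<beta> \<alpha> y \<in> G \<alpha>" "x \<odot> y \<in> G \<beta>" "x \<odot> x \<in> G \<alpha>"
    using assms y phi_closed psi_closed mul_mem[of x \<alpha> y \<beta>] mul_mem[of x \<alpha> x \<alpha>]
    by (simp_all add: inf_absorb2)
  \<comment> \<open>The second summand matters only through its component, so \<open>x\<close>
    itself can represent \<open>G \<alpha>\<close>.\<close>
  have "x \<odot> \<psi> \<beta> \<alpha> y = x \<odot> (y \<boxplus> x)"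
    using add_eq_psi[OF y assms(2)] assms(1) by (simp add: sup_absorb2)
  \<comment> \<open>Distributivity is used in the whole semiring \<open>S\<close>, since the
    summands lie in components that may differ.\<close>
  also have "\<dots> = x \<odot> y \<boxplus> x \<odot> x"
    using assms(2) y union by (intro distrib_left) auto
  also have "\<dots> = \<psi> \<beta> \<alpha> (x \<odot> y)"
    using add_eq_psi[OF mem(3,4)] assms(1) by (simp add: sup_absorb2)
  also have "\<dots> = \<psi> \<beta> \<alpha> (\<phi> \<alpha> \<beta> x) \<odot> \<psi> \<beta> \<alpha> y"
    using mul_eq_phi[OF assms y] psi_mul[OF assms(1) mem(1) y] by simp
  finally show ?thesis
    using right_cancel_component assms mem psi_closed by metis
qed

lemma phi_bij_betw: "\<beta> \<le> \<alpha> \<Longrightarrow> bij_betw (\<phi> \<alpha> \<beta>) (G \<alpha>) (G \<beta>)"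
  by (rule bij_betw_byWitness[where f' = "\<psi> \<beta> \<alpha>"])
    (auto simp: psi_phi_inverse phi_psi_inverse phi_closed psi_closed)

lemma phi_iso: "\<beta> \<le> \<alpha> \<Longrightarrow> \<phi> \<alpha> \<beta> \<in> semiring_iso add mul (G \<alpha>) (G \<beta>)"
  by (simp add: semiring_iso_def phi_hom phi_bij_betw)

lemma psi_eq_inv_phi:
  assumes "\<beta> \<le> \<alpha>" "y \<in> G \<beta>"
  shows "\<psi> \<beta> \<alpha> y = inv_into (G \<alpha>) (\<phi> \<alpha> \<beta>) y"
  by (rule inv_into_f_eq[symmetric])
    (use assms phi_bij_betw psi_closed phi_psi_inverse in \<open>auto simp: bij_betw_def\<close>)

text \<open>The detour through \<gamma> factors through the meet of \<alpha> and \<beta>. Going down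
  from the meet to \<gamma> and back up is the identity, which leaves the compatibility
  axiom.\<close>

lemma phi_psi_below:
  assumes "sup \<alpha> \<beta> \<le> \<delta>" "\<gamma> \<le> inf \<alpha> \<beta>" "x \<in> G \<alpha>"
  shows "\<psi> \<gamma> \<beta> (\<phi> \<alpha> \<gamma> x) = \<phi> \<delta> \<beta> (\<psi> \<alpha> \<delta> x)"
proof -
  let ?\<mu> = "inf \<alpha> \<beta>"
  have mem: "\<phi> \<alpha> ?\<mu> x \<in> G ?\<mu>" "\<phi> \<alpha> \<gamma> x \<in> G \<gamma>"
    using assms phi_closed by simp_all
  have "\<psi> \<gamma> \<beta> (\<phi> \<alpha> \<gamma> x) = \<psi> ?\<mu> \<beta> (\<psi> \<gamma> ?\<mu> (\<phi> ?\<mu> \<gamma> (\<phi> \<alpha> ?\<mu> x)))"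
    using assms mem by (simp add: phi_comp psi_comp)
  also have "\<dots> = \<phi> \<delta> \<beta> (\<psi> \<alpha> \<delta> x)"
    using assms mem by (simp add: psi_phi_inverse phi_psi)
  finally show ?thesis .
qed

text \<open>A multiplicative map between groups preserves the identity. With
  \<open>\<phi> \<alpha> \<beta>\<close> written as multiplication by the identity of
  \<open>G \<beta>\<close>, this evaluates the product of the two identities.\<close>

lemma phi_one:
  assumes "\<beta> \<le> \<alpha>"
    and \<alpha>: "group \<lparr>carrier = G \<alpha>, mult = mul, one = e\<^sub>\<alpha>\<rparr>"
    and \<beta>: "group \<lparr>carrier = G \<beta>, mult = mul, one = e\<^sub>\<beta>\<rparr>"
  shows "\<phi> \<alpha> \<beta> e\<^sub>\<alpha> = e\<^sub>\<beta>"
proof -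
  have "\<phi> \<alpha> \<beta> \<in> hom \<lparr>carrier = G \<alpha>, mult = mul, one = e\<^sub>\<alpha>\<rparr> \<lparr>carrier = G \<beta>, mult = mul, one = e\<^sub>\<beta>\<rparr>"
    using assms(1) by (auto simp: hom_def phi_closed phi_mul)
  from hom_one[OF this \<alpha> \<beta>] show ?thesis by simp
qed

end

theorem theorem3p3:
  fixes S :: "'a set"
    and add :: "'a \<Rightarrow> 'a \<Rightarrow> 'a" (infixl "\<boxplus>" 65)
    and mul :: "'a \<Rightarrow> 'a \<Rightarrow> 'a" (infixl "\<odot>" 70)
    and G :: "'d::distrib_lattice \<Rightarrow> 'a set"
    and \<phi> \<psi> :: "'d \<Rightarrow> 'd \<Rightarrow> 'a \<Rightarrow> 'a"
    and e :: "'d \<Rightarrow> 'a"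
  assumes "strong_distrib_lattice_of_group_semirings S add mul G \<phi> \<psi>"
    and "\<And>\<alpha>. group \<lparr>carrier = G \<alpha>, mult = mul, one = e \<alpha>\<rparr>"
  shows "(\<forall>\<alpha> \<beta>. \<beta> \<le> \<alpha> \<longrightarrow> e \<alpha> \<odot> e \<beta> = e \<beta> \<and> e \<alpha> \<boxplus> e \<beta> = e \<alpha>) \<and>
    (\<forall>\<alpha> \<beta>. \<forall>x\<in>G \<alpha>. \<forall>y\<in>G \<beta>. \<forall>y'\<in>G \<beta>. x \<boxplus> y = x \<boxplus> y') \<and>
    (\<forall>\<alpha> \<beta>. \<beta> \<le> \<alpha> \<longrightarrow>
       (\<forall>x\<in>G \<alpha>. \<phi> \<alpha> \<beta> x = x \<odot> e \<beta>) \<and> (\<forall>y\<in>G \<beta>. \<psi> \<beta> \<alpha> y = y \<boxplus> e \<alpha>)) \<and>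
    (\<forall>\<alpha> \<beta> \<gamma>. \<gamma> \<le> \<beta> \<and> \<beta> \<le> \<alpha> \<longrightarrow> (\<forall>x\<in>G \<alpha>. \<phi> \<beta> \<gamma> (\<phi> \<alpha> \<beta> x) = \<phi> \<alpha> \<gamma> x)) \<and>
    (\<forall>\<alpha> \<beta>. \<beta> \<le> \<alpha> \<longrightarrow>
       \<phi> \<alpha> \<beta> \<in> semiring_iso add mul (G \<alpha>) (G \<beta>) \<and>
       (\<forall>y\<in>G \<beta>. \<psi> \<beta> \<alpha> y = inv_into (G \<alpha>) (\<phi> \<alpha> \<beta>) y)) \<and>
    (\<forall>\<alpha> \<beta> \<gamma> \<delta>. sup \<alpha> \<beta> \<le> \<delta> \<and> \<gamma> \<le> inf \<alpha> \<beta> \<longrightarrow>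
       (\<forall>x\<in>G \<alpha>. \<psi> \<gamma> \<beta> (\<phi> \<alpha> \<gamma> x) = \<phi> \<delta> \<beta> (\<psi> \<alpha> \<delta> x)))"
proof -
  interpret strong_distrib_lattice_of_group_semirings S add mul G \<phi> \<psi>
    by (rule assms(1))
  have e: "e \<alpha> \<in> G \<alpha>" for \<alpha>
    using monoid.one_closed[OF group.is_monoid[OF assms(2)[of \<alpha>]]] by simp
  have unit: "x \<odot> e \<alpha> = x" if "x \<in> G \<alpha>" for x \<alpha>
    using monoid.r_one[OF group.is_monoid[OF assms(2)[of \<alpha>]]] that by simp
  have phi_e: "\<phi> \<alpha> \<beta> x = x \<odot> e \<beta>" if "\<beta> \<le> \<alpha>" "x \<in> G \<alpha>" for \<alpha> \<beta> x
    using mul_eq_phi[OF that e] unit[OF phi_closed[OF that]] by simp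
  have psi_e: "\<psi> \<beta> \<alpha> y = y \<boxplus> e \<alpha>" if "\<beta> \<le> \<alpha>" "y \<in> G \<beta>" for \<alpha> \<beta> y
    using add_eq_psi[OF that(2) e, of \<alpha>] that(1) by (simp add: sup_absorb2)
  have "e \<alpha> \<odot> e \<beta> = e \<beta>" "e \<alpha> \<boxplus> e \<beta> = e \<alpha>" if "\<beta> \<le> \<alpha>" for \<alpha> \<beta>
    using phi_e[OF that e] phi_one[OF that assms(2) assms(2)]
      add_eq_psi[OF e e, of \<alpha> \<beta>] that by (simp_all add: sup_absorb1 psi_id e)
  \<comment> \<open>Both sums equal \<open>\<psi> \<alpha> (sup \<alpha> \<beta>) x\<close>, which
    depends on the right summand only through its index.\<close>
  moreover have "x \<boxplus> y = x \<boxplus> y'" if "x \<in> G \<alpha>" "y \<in> G \<beta>" "y' \<in> G \<beta>" for \<alpha> \<beta> x y y'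
    using that by (simp add: add_eq_psi[of x \<alpha> _ \<beta>])
  ultimately show ?thesis
    by (intro conjI allI ballI impI; (elim conjE)?)
      (assumption | rule phi_e psi_e phi_comp phi_iso psi_eq_inv_phi phi_psi_below | simp)+
qed

end
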